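(* (1) The relation $\leadsto_{loop}$ on atoms is reflexive and transitive. (2) For atoms $A_1,A_2$, if $A_1\leadsto_{loop}A_2$ then $|A_1|\le|A_2|$. (3) For goals $G_1,G_2,G_3$ (labelling nodes of a generalized SLDNF-derivation), if $G_3$ is a loop goal of $G_2$ and $G_2$ is a loop goal of $G_1$, then $G_3$ is a loop goal of $G_1$.
   Context: Terms are constants, variables, or $f(T_1,\dots,T_m)$; atoms are $p(T_1,\dots,T_m)$. In lists $[\,]$ and $[T|L]$ the symbols $[$, $]$, $|$ are treated as function symbols. The size $|A|$ of an atom/term $A$ is the number of occurrences of function symbols, variables and constants in $A$. The symbol string $S_T$ of a term or atom $T$ is the string of all predicate symbols, function symbols, constants and variables of $T$ read left to right, with every variable replaced by a single symbol $\mathcal{X}$. For symbol strings, $S_1\subseteq_{proj}S_2$ means $S_1$ is obtained from $S_2$ by removing zero or more elements. For atoms $A_1=p(\ldots)$ and $A_2=p(\ldots)$ with the same predicate symbol $p$, $A_1\leadsto_{loop}A_2$ ($A_1$ loops into $A_2$) means $S_{A_1}\subseteq_{proj}S_{A_2}$. Generalized SLDNF-derivations: for a general logic program $P$ and a top goal $G_0=\leftarrow A_0$ ($A_0$ an atom), with the depth-first, left-most strategy (leftmost literal selected, clauses in textual order), the generalized SLDNF-tree consists of the SLDNF$^*$-tree rooted at $N_0:G_0$ with empty ancestor list $AL_{A_0@N_0}=\emptyset$ together with all its (recursively) subsidiary SLDNF$^*$-trees, each node with a ground negative selected literal $\neg A$ being linked by a dotted edge to the root $\leftarrow A$ of its subsidiary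 tree. In SLDNF$^*$-trees every literal $L$ at node $M$ carries an ancestor list $AL_{L@M}$: when a node $N_i$ with selected positive literal $L_1$ is resolved with a clause $B\leftarrow B_1,\dots,B_n$ (mgu $\theta$), each new literal $B_k\theta$ at the child gets ancestor list $\{(N_i,L_1)\}\cup AL_{L_1@N_i}$ while the remaining literals keep their lists; the root $\leftarrow A$ of a subsidiary tree for a negative literal $L_1=\neg A$ at $N_i$ gets $AL_{A@N_{i+1}}=AL_{L_1@N_i}$. A generalized SLDNF-derivation is a path of the generalized SLDNF-tree from $N_0$ along tree edges and dotted edges. For a node $N_i:G_i$, $L_i^1$ denotes the selected (leftmost) subgoal of $G_i$; $L_i^1\prec_{anc}L_j^1$ ($L_i^1$ is an ancestor subgoal of $L_j^1$) means $(N_i,L_i^1)\in AL_{L_j^1@N_j}$. If $N_i:G_i$ and $N_j:G_j$ are nodes in a generalized SLDNF-derivation with $L_i^1\prec_{anc}L_j^1$ and $L_i^1\leadsto_{loop}L_j^1$, then $G_j$ is called a loop goal of $G_i$. *)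

theory Defs
  imports Main "HOL-Library.Sublist"
begin

section \<open>Terms, atoms and general logic programs\<close>

text \<open>
  Constants are function symbols applied to no arguments. The lists \<open>[]\<close> and \<open>[T|L]\<close> are separate
  constructors because each of the three symbols \<open>[\<close>, \<open>|\<close>, \<open>]\<close> counts as a function symbol of its own.
\<close>

datatype ('f, 'v) trm =
    Var 'v
  | Fun 'f "('f, 'v) trm list"
  | LNil
  | LCons "('f, 'v) trm" "('f, 'v) trm"

datatype ('p, 'f, 'v) atom = Atom (pred: 'p) (args: "('f, 'v) trm list")

datatype ('p, 'f, 'v) lit = Pos "('p, 'f, 'v) atom" | Neg "('p, 'f, 'v) atom"

datatype ('p, 'f, 'v) clause =
  Clause (head: "('p, 'f, 'v) atom") (body: "('p, 'f, 'v) lit list")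

text \<open>A program is a list of clauses: their textual order is part of the program.\<close>

type_synonym ('p, 'f, 'v) program = "('p, 'f, 'v) clause list"


section \<open>Size and symbol strings\<close>

fun trm_size :: "('f, 'v) trm \<Rightarrow> nat" where
  "trm_size (Var x) = 1"
| "trm_size (Fun f ts) = 1 + (\<Sum>t\<leftarrow>ts. trm_size t)"
| "trm_size LNil = 2"
| "trm_size (LCons t l) = 3 + trm_size t + trm_size l"

text \<open>The predicate symbol does not count.\<close>

fun atom_size :: "('p, 'f, 'v) atom \<Rightarrow> nat" where
  "atom_size (Atom p ts) = (\<Sum>t\<leftarrow>ts. trm_size t)"

text \<open>
  A predicate or function symbol is identified by its name together with its arity.
  \<open>VarSym\<close> is the single symbol that replaces every variable.
\<close>

datatype ('p, 'f) sym = PredSym 'p nat | FunSym 'f nat | LBrack | Bar | RBrack | VarSym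

fun trm_string :: "('f, 'v) trm \<Rightarrow> ('p, 'f) sym list" where
  "trm_string (Var x) = [VarSym]"
| "trm_string (Fun f ts) = FunSym f (length ts) # concat (map trm_string ts)"
| "trm_string LNil = [LBrack, RBrack]"
| "trm_string (LCons t l) = [LBrack] @ trm_string t @ [Bar] @ trm_string l @ [RBrack]"

fun atom_string :: "('p, 'f, 'v) atom \<Rightarrow> ('p, 'f) sym list" where
  "atom_string (Atom p ts) = PredSym p (length ts) # concat (map trm_string ts)"

definition loops_into :: "('p, 'f, 'v) atom \<Rightarrow> ('p, 'f, 'v) atom \<Rightarrow> bool"
    (infix "\<leadsto>loop" 50) where
  "A\<^sub>1 \<leadsto>loop A\<^sub>2 \<longleftrightarrow>
     pred A\<^sub>1 = pred A\<^sub>2 \<and> length (args A\<^sub>1) = length (args A\<^sub>2) \<and>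
     subseq (atom_string A\<^sub>1) (atom_string A\<^sub>2)"


section \<open>Substitutions and most general unifiers\<close>

fun trm_vars :: "('f, 'v) trm \<Rightarrow> 'v set" where
  "trm_vars (Var x) = {x}"
| "trm_vars (Fun f ts) = (\<Union>t\<in>set ts. trm_vars t)"
| "trm_vars LNil = {}"
| "trm_vars (LCons t l) = trm_vars t \<union> trm_vars l"

fun atom_vars :: "('p, 'f, 'v) atom \<Rightarrow> 'v set" where
  "atom_vars (Atom p ts) = (\<Union>t\<in>set ts. trm_vars t)"

fun lit_vars :: "('p, 'f, 'v) lit \<Rightarrow> 'v set" where
  "lit_vars (Pos A) = atom_vars A"
| "lit_vars (Neg A) = atom_vars A"

fun clause_vars :: "('p, 'f, 'v) clause \<Rightarrow> 'v set" where
  "clause_vars (Clause B Bs) = atom_vars B \<union> (\<Union>L\<in>set Bs. lit_vars L)"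

fun trm_subst :: "('v \<Rightarrow> ('f, 'v) trm) \<Rightarrow> ('f, 'v) trm \<Rightarrow> ('f, 'v) trm" where
  "trm_subst \<theta> (Var x) = \<theta> x"
| "trm_subst \<theta> (Fun f ts) = Fun f (map (trm_subst \<theta>) ts)"
| "trm_subst \<theta> LNil = LNil"
| "trm_subst \<theta> (LCons t l) = LCons (trm_subst \<theta> t) (trm_subst \<theta> l)"

fun atom_subst :: "('v \<Rightarrow> ('f, 'v) trm) \<Rightarrow> ('p, 'f, 'v) atom \<Rightarrow> ('p, 'f, 'v) atom" where
  "atom_subst \<theta> (Atom p ts) = Atom p (map (trm_subst \<theta>) ts)"

fun lit_subst :: "('v \<Rightarrow> ('f, 'v) trm) \<Rightarrow> ('p, 'f, 'v) lit \<Rightarrow> ('p, 'f, 'v) lit" where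
  "lit_subst \<theta> (Pos A) = Pos (atom_subst \<theta> A)"
| "lit_subst \<theta> (Neg A) = Neg (atom_subst \<theta> A)"

fun clause_subst :: "('v \<Rightarrow> ('f, 'v) trm) \<Rightarrow> ('p, 'f, 'v) clause \<Rightarrow> ('p, 'f, 'v) clause" where
  "clause_subst \<theta> (Clause B Bs) = Clause (atom_subst \<theta> B) (map (lit_subst \<theta>) Bs)"

definition is_subst :: "('v \<Rightarrow> ('f, 'v) trm) \<Rightarrow> bool" where
  "is_subst \<theta> \<longleftrightarrow> finite {x. \<theta> x \<noteq> Var x}"

definition is_unifier ::
    "('v \<Rightarrow> ('f, 'v) trm) \<Rightarrow> ('p, 'f, 'v) atom \<Rightarrow> ('p, 'f, 'v) atom \<Rightarrow> bool" where
  "is_unifier \<theta> A B \<longleftrightarrow> is_subst \<theta> \<and> atom_subst \<theta> A = atom_subst \<theta> B"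

definition is_mgu ::
    "('v \<Rightarrow> ('f, 'v) trm) \<Rightarrow> ('p, 'f, 'v) atom \<Rightarrow> ('p, 'f, 'v) atom \<Rightarrow> bool" where
  "is_mgu \<theta> A B \<longleftrightarrow> is_unifier \<theta> A B \<and>
     (\<forall>\<sigma>. is_unifier \<sigma> A B \<longrightarrow> (\<exists>\<delta>. is_subst \<delta> \<and> (\<forall>x. \<sigma> x = trm_subst \<delta> (\<theta> x))))"

definition is_variant :: "('p, 'f, 'v) clause \<Rightarrow> ('p, 'f, 'v) clause \<Rightarrow> bool" where
  "is_variant C C' \<longleftrightarrow> (\<exists>\<rho>. inj_on \<rho> (clause_vars C) \<and> C' = clause_subst (\<lambda>x. Var (\<rho> x)) C)"


section \<open>Generalized SLDNF-trees\<close>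

text \<open>
  A node is the sequence of edges leading to it from the root \<open>N\<^sub>0 = []\<close>, so distinct nodes are
  distinct even when they carry the same goal. \<open>Res i\<close> is resolution with the \<open>i\<close>-th clause of the
  program, \<open>Naf\<close> removes a selected ground literal \<open>\<not>A\<close> whose subsidiary tree has finitely
  failed, and \<open>Dotted\<close> is the dotted edge to the root of the subsidiary tree.
\<close>

datatype edge = Res nat | Naf | Dotted

type_synonym node = "edge list"

type_synonym ('p, 'f, 'v) anc_list = "(node \<times> ('p, 'f, 'v) lit) set"

text \<open>Every literal \<open>L\<close> of the goal at node \<open>N\<close> is paired with its ancestor list.\<close>

type_synonym ('p, 'f, 'v) goal = "(('p, 'f, 'v) lit \<times> ('p, 'f, 'v) anc_list) list"

text \<open>A tree is given by the goals labelling its nodes; positions that are not nodes have no goal.\<close>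

type_synonym ('p, 'f, 'v) labelling = "node \<Rightarrow> ('p, 'f, 'v) goal option"

definition goal_vars :: "('p, 'f, 'v) goal \<Rightarrow> 'v set" where
  "goal_vars G = (\<Union>(L, al)\<in>set G. lit_vars L)"

text \<open>
  \<open>resolvent N A al R C G'\<close>: the goal \<open>G'\<close> results from resolving the goal \<open>\<leftarrow> A, R\<close> at \<open>N\<close> with a
  variant of \<open>C\<close> standardized apart from that goal, where \<open>al\<close> is the ancestor list of \<open>A\<close>.
\<close>

definition resolvent ::
    "node \<Rightarrow> ('p, 'f, 'v) atom \<Rightarrow> ('p, 'f, 'v) anc_list \<Rightarrow> ('p, 'f, 'v) goal \<Rightarrow>
     ('p, 'f, 'v) clause \<Rightarrow> ('p, 'f, 'v) goal \<Rightarrow> bool" where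
  "resolvent N A al R C G' \<longleftrightarrow>
     (\<exists>C' \<theta>. is_variant C C' \<and> clause_vars C' \<inter> goal_vars ((Pos A, al) # R) = {} \<and>
        is_mgu \<theta> A (head C') \<and>
        G' = map (\<lambda>B. (lit_subst \<theta> B, insert (N, Pos A) al)) (body C') @
             map (\<lambda>(L, al'). (lit_subst \<theta> L, al')) R)"

text \<open>
  \<open>has_success T N\<close>: the part below \<open>N\<close> of the SLDNF*-tree containing \<open>N\<close> has a success leaf (an empty goal).
  \<open>fin_failed T N\<close>: that part is finite and all its leaves are failure leaves. Nodes with a selected
  non-ground negative literal are flounder leaves, so neither predicate holds of them. The
  simultaneous least fixpoint ensures that infinitely nested subsidiary trees
  (as for \<open>p \<leftarrow> \<not>p\<close>) give neither success nor finite failure.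
\<close>

inductive has_success :: "('p, 'f, 'v) labelling \<Rightarrow> node \<Rightarrow> bool"
  and fin_failed :: "('p, 'f, 'v) labelling \<Rightarrow> node \<Rightarrow> bool"
  for T :: "('p, 'f, 'v) labelling" where
  success_leaf: "T N = Some [] \<Longrightarrow> has_success T N"
| success_pos: "T N = Some ((Pos A, al) # R) \<Longrightarrow> has_success T (N @ [Res i]) \<Longrightarrow> has_success T N"
| success_neg: "T N = Some ((Neg A, al) # R) \<Longrightarrow> atom_vars A = {} \<Longrightarrow>
    fin_failed T (N @ [Dotted]) \<Longrightarrow> has_success T (N @ [Naf]) \<Longrightarrow> has_success T N"
| failed_pos: "T N = Some ((Pos A, al) # R) \<Longrightarrow>
    (\<And>i. T (N @ [Res i]) \<noteq> None \<Longrightarrow> fin_failed T (N @ [Res i])) \<Longrightarrow> fin_failed T N"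
| failed_neg_success: "T N = Some ((Neg A, al) # R) \<Longrightarrow> atom_vars A = {} \<Longrightarrow>
    has_success T (N @ [Dotted]) \<Longrightarrow> fin_failed T N"
| failed_neg_failed: "T N = Some ((Neg A, al) # R) \<Longrightarrow> atom_vars A = {} \<Longrightarrow>
    fin_failed T (N @ [Dotted]) \<Longrightarrow> fin_failed T (N @ [Naf]) \<Longrightarrow> fin_failed T N"

text \<open>
  \<open>T\<close> is a generalized SLDNF-tree for the program \<open>P\<close> and the top goal \<open>\<leftarrow> A\<^sub>0\<close>; it is unique up to the
  choice of clause variants and most general unifiers. The success and failure marks of leaves
  are not nodes of their own. A node with a selected ground literal \<open>\<not>A\<close> always has the dotted edge
  to its subsidiary tree, and it has a child in its own tree exactly if that subsidiary tree
  finitely fails.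
\<close>

definition gsldnf_tree ::
    "('p, 'f, 'v) program \<Rightarrow> ('p, 'f, 'v) atom \<Rightarrow> ('p, 'f, 'v) labelling \<Rightarrow> bool" where
  "gsldnf_tree P A\<^sub>0 T \<longleftrightarrow>
     T [] = Some [(Pos A\<^sub>0, {})] \<and>
     (\<forall>N. case T N of
        None \<Rightarrow> (\<forall>e. T (N @ [e]) = None)
      | Some [] \<Rightarrow> (\<forall>e. T (N @ [e]) = None)
      | Some ((Pos A, al) # R) \<Rightarrow>
          (\<forall>i. case T (N @ [Res i]) of
             None \<Rightarrow> \<not> (i < length P \<and> (\<exists>G'. resolvent N A al R (P ! i) G'))
           | Some G' \<Rightarrow> i < length P \<and> resolvent N A al R (P ! i) G') \<and>
          T (N @ [Naf]) = None \<and> T (N @ [Dotted]) = None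
      | Some ((Neg A, al) # R) \<Rightarrow>
          (\<forall>i. T (N @ [Res i]) = None) \<and>
          T (N @ [Dotted]) = (if atom_vars A = {} then Some [(Pos A, al)] else None) \<and>
          T (N @ [Naf]) =
            (if atom_vars A = {} \<and> fin_failed T (N @ [Dotted]) then Some R else None))"


section \<open>Generalized SLDNF-derivations and loop goals\<close>

text \<open>A path from the root, finite (\<open>D n = None\<close> from some \<open>n\<close> on) or infinite.\<close>

definition gsldnf_derivation :: "('p, 'f, 'v) labelling \<Rightarrow> (nat \<Rightarrow> node option) \<Rightarrow> bool" where
  "gsldnf_derivation T D \<longleftrightarrow>
     D 0 = Some [] \<and>
     (\<forall>n M. D (Suc n) = Some M \<longrightarrow> (\<exists>N e. D n = Some N \<and> M = N @ [e] \<and> T M \<noteq> None))"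

fun selected :: "('p, 'f, 'v) goal option \<Rightarrow> (('p, 'f, 'v) lit \<times> ('p, 'f, 'v) anc_list) option" where
  "selected (Some (L # G)) = Some L"
| "selected _ = None"

text \<open>The selected subgoal at \<open>N\<^sub>i\<close> is an ancestor subgoal of the selected subgoal at \<open>N\<^sub>j\<close>.\<close>

definition anc_subgoal :: "('p, 'f, 'v) labelling \<Rightarrow> node \<Rightarrow> node \<Rightarrow> bool" where
  "anc_subgoal T N\<^sub>i N\<^sub>j \<longleftrightarrow>
     (\<exists>L\<^sub>i al\<^sub>i L\<^sub>j al\<^sub>j. selected (T N\<^sub>i) = Some (L\<^sub>i, al\<^sub>i) \<and> selected (T N\<^sub>j) = Some (L\<^sub>j, al\<^sub>j) \<and>
        (N\<^sub>i, L\<^sub>i) \<in> al\<^sub>j)"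

text \<open>
  The goal at \<open>N\<^sub>j\<close> is a loop goal of the goal at \<open>N\<^sub>i\<close>. Since \<open>\<leadsto>loop\<close> relates atoms, both selected
  subgoals have to be positive.
\<close>

definition loop_goal ::
    "('p, 'f, 'v) labelling \<Rightarrow> (nat \<Rightarrow> node option) \<Rightarrow> node \<Rightarrow> node \<Rightarrow> bool" where
  "loop_goal T D N\<^sub>j N\<^sub>i \<longleftrightarrow>
     Some N\<^sub>i \<in> range D \<and> Some N\<^sub>j \<in> range D \<and> anc_subgoal T N\<^sub>i N\<^sub>j \<and>
     (\<exists>A\<^sub>i al\<^sub>i A\<^sub>j al\<^sub>j. selected (T N\<^sub>i) = Some (Pos A\<^sub>i, al\<^sub>i) \<and> selected (T N\<^sub>j) = Some (Pos A\<^sub>j, al\<^sub>j) \<and>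
        A\<^sub>i \<leadsto>loop A\<^sub>j)"

end

theory Submission
  imports Defs
begin

text \<open>
  Size is the length of the symbol string without its predicate symbol, so (1) and (2) are facts
  about subsequences. For (3), every entry \<open>(M, K)\<close> of an ancestor list \<open>al\<close> occurring in a
  generalized SLDNF-tree satisfies: \<open>K\<close> is the literal selected at \<open>M\<close>, and its own ancestor list is
  contained in \<open>al\<close>. This is preserved along every edge and makes the ancestor relation transitive.
\<close>

lemma length_trm_string: "length (trm_string t :: ('p, 'f) sym list) = trm_size t"
proof (induction t)
  case (Fun f ts)
  then have "map (length \<circ> (trm_string :: _ \<Rightarrow> ('p, 'f) sym list)) ts = map trm_size ts"
    by simp
  then show ?case
    \<comment> \<open>Without \<open>map_eq_conv\<close> the chained equation stays a rewrite rule
      between whole lists instead of becoming a pointwise statement.\<close>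
    by (simp add: length_concat del: map_eq_conv)
qed simp_all

text \<open>The extra one is the predicate symbol, which occurs in the string but is not counted in
  the size; it cancels when two atoms are compared.\<close>

lemma length_atom_string: "length (atom_string A) = Suc (atom_size A)"
  by (cases A) (simp add: length_concat comp_def length_trm_string)

lemma reflp_loops_into: "reflp loops_into"
  by (simp add: reflp_def loops_into_def)

lemma transp_loops_into: "transp loops_into"
  by (auto simp: transp_def loops_into_def intro: subseq_order.trans)

lemma loops_into_atom_size_le: "A\<^sub>1 \<leadsto>loop A\<^sub>2 \<Longrightarrow> atom_size A\<^sub>1 \<le> atom_size A\<^sub>2"
  using list_emb_length[of "(=)" "atom_string A\<^sub>1" "atom_string A\<^sub>2"]
  by (simp add: loops_into_def length_atom_string)

definition anc_closed :: "('p, 'f, 'v) labelling \<Rightarrow> ('p, 'f, 'v) anc_list \<Rightarrow> bool" where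
  "anc_closed T al \<longleftrightarrow>
     (\<forall>(M, K)\<in>al. \<exists>al'. selected (T M) = Some (K, al') \<and> al' \<subseteq> al)"

lemma anc_closed_insert_selected:
  assumes "anc_closed T al" and "selected (T N) = Some (L, al)"
  shows "anc_closed T (insert (N, L) al)"
  using assms unfolding anc_closed_def by fastforce

text \<open>The unifier acts on literals only, so ancestor lists pass through resolution
  unchanged.\<close>

lemma resolvent_anc_lists:
  assumes "resolvent N A al R C G'" and "(L, al') \<in> set G'"
  shows "al' = insert (N, Pos A) al \<or> al' \<in> snd ` set R"
  using assms unfolding resolvent_def by force

lemma gsldnf_tree_child_cases:
  assumes tree: "gsldnf_tree P A\<^sub>0 T" and child: "T (N @ [e]) = Some G'"
  obtains (Res) A al R C where "T N = Some ((Pos A, al) # R)" "resolvent N A al R C G'"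
  | (Naf) A al R where "T N = Some ((Neg A, al) # R)" "G' = R"
  | (Dotted) A al R where "T N = Some ((Neg A, al) # R)" "G' = [(Pos A, al)]"
proof -
  note step = tree[unfolded gsldnf_tree_def, THEN conjunct2, rule_format, of N]
  \<comment> \<open>A position without a goal, or with the empty goal, has no children, so the child
    forces a selected literal at \<open>N\<close>.\<close>
  obtain L al R where TN: "T N = Some ((L, al) # R)"
    using step child by (auto split: option.splits list.splits)
  show thesis
  proof (cases L)
    case (Pos A)
    then obtain i where i: "e = Res i"
      using step child TN by (cases e) auto
    have "resolvent N A al R (P ! i) G'"
      using step child TN Pos i by (auto split: option.splits dest: spec[of _ i])
    then show thesis using Res TN Pos by blast
  next
    case (Neg A)
    then show thesis
      using step child TN Naf Dotted by (cases e) (auto split: if_splits)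
  qed
qed

text \<open>A node is its path from the root, so reverse list induction moves from parent to child.
  All literals of the goal are covered, not just the selected one, because the others may be
  selected further down.\<close>

lemma gsldnf_tree_anc_closed:
  assumes tree: "gsldnf_tree P A\<^sub>0 T"
  shows "T N = Some G \<Longrightarrow> (L, al) \<in> set G \<Longrightarrow> anc_closed T al"
proof (induction N arbitrary: G L al rule: rev_induct)
  case Nil
  then show ?case using tree by (auto simp: gsldnf_tree_def anc_closed_def)
next
  case (snoc e N)
  from tree snoc.prems(1) show ?case
  proof (cases rule: gsldnf_tree_child_cases)
    case (Res A al' R C)
    consider "al = insert (N, Pos A) al'" | "al \<in> snd ` set R"
      using resolvent_anc_lists[OF Res(2) snoc.prems(2)] by blast
    then show ?thesis
    proof cases
      case 1
      have "anc_closed T al'" using snoc.IH[OF Res(1), of "Pos A" al'] by simp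
      then show ?thesis using 1 Res(1) by (simp add: anc_closed_insert_selected)
    next
      case 2
      then show ?thesis using snoc.IH[OF Res(1)] by fastforce
    qed
  next
    case (Naf A al' R)
    then show ?thesis using snoc.IH[OF Naf(1), of L al] snoc.prems(2) by simp
  next
    case (Dotted A al' R)
    then show ?thesis using snoc.IH[OF Dotted(1), of "Neg A" al'] snoc.prems(2) by simp
  qed
qed

lemma selected_SomeD: "selected X = Some L \<Longrightarrow> \<exists>G. X = Some G \<and> L \<in> set G"
  by (cases X rule: selected.cases) auto

lemma anc_subgoal_trans:
  assumes tree: "gsldnf_tree P A\<^sub>0 T" and "anc_subgoal T N\<^sub>1 N\<^sub>2" and "anc_subgoal T N\<^sub>2 N\<^sub>3"
  shows "anc_subgoal T N\<^sub>1 N\<^sub>3"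
proof -
  obtain L\<^sub>1 al\<^sub>1 L\<^sub>2 al\<^sub>2 L\<^sub>3 al\<^sub>3 where
    sel: "selected (T N\<^sub>1) = Some (L\<^sub>1, al\<^sub>1)" "selected (T N\<^sub>2) = Some (L\<^sub>2, al\<^sub>2)"
      "selected (T N\<^sub>3) = Some (L\<^sub>3, al\<^sub>3)"
    and anc: "(N\<^sub>1, L\<^sub>1) \<in> al\<^sub>2" "(N\<^sub>2, L\<^sub>2) \<in> al\<^sub>3"
    using assms(2,3) unfolding anc_subgoal_def by auto
  have "anc_closed T al\<^sub>3"
    using gsldnf_tree_anc_closed[OF tree] selected_SomeD[OF sel(3)] by blast
  \<comment> \<open>Closedness yields some list for the entry \<open>(N\<^sub>2, L\<^sub>2)\<close>;
    since \<open>selected\<close> is a function, it is \<open>al\<^sub>2\<close>.\<close>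
  then have "al\<^sub>2 \<subseteq> al\<^sub>3"
    using anc(2) sel(2) unfolding anc_closed_def by fastforce
  then show ?thesis
    using sel(1,3) anc(1) unfolding anc_subgoal_def by blast
qed

lemma loop_goal_trans:
  assumes tree: "gsldnf_tree P A\<^sub>0 T" and "loop_goal T D N\<^sub>3 N\<^sub>2" and "loop_goal T D N\<^sub>2 N\<^sub>1"
  shows "loop_goal T D N\<^sub>3 N\<^sub>1"
proof -
  have "anc_subgoal T N\<^sub>1 N\<^sub>3"
    using assms(2,3) anc_subgoal_trans[OF tree] unfolding loop_goal_def by blast
  \<comment> \<open>Both hypotheses speak of the same atom at \<open>N\<^sub>2\<close>, the one
    selected there, so \<open>\<leadsto>loop\<close> can be chained through it.\<close>
  then show ?thesis
    using assms(2,3) transpD[OF transp_loops_into] unfolding loop_goal_def by fastforce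
qed

theorem theorem3p4:
  shows "(reflp (loops_into :: ('p, 'f, 'v) atom \<Rightarrow> ('p, 'f, 'v) atom \<Rightarrow> bool) \<and>
          transp (loops_into :: ('p, 'f, 'v) atom \<Rightarrow> ('p, 'f, 'v) atom \<Rightarrow> bool)) \<and>
         (\<forall>A\<^sub>1 A\<^sub>2 :: ('p, 'f, 'v) atom. A\<^sub>1 \<leadsto>loop A\<^sub>2 \<longrightarrow> atom_size A\<^sub>1 \<le> atom_size A\<^sub>2) \<and>
         (\<forall>(P :: ('p, 'f, 'v) program) A\<^sub>0 T D N\<^sub>1 N\<^sub>2 N\<^sub>3.
            gsldnf_tree P A\<^sub>0 T \<longrightarrow> gsldnf_derivation T D \<longrightarrow>
            loop_goal T D N\<^sub>3 N\<^sub>2 \<longrightarrow> loop_goal T D N\<^sub>2 N\<^sub>1 \<longrightarrow> loop_goal T D N\<^sub>3 N\<^sub>1)"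
  using reflp_loops_into transp_loops_into loops_into_atom_size_le loop_goal_trans by blast

end
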